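(* Let $k$ be a real number with $9k^2>8$, let $\lambda_1=\frac{3k+\sqrt{9k^2-8}}{2}$, $\lambda_2=\frac{3k-\sqrt{9k^2-8}}{2}$, and let $\alpha=\sum_{r=0}^{7}\lambda_1^{r}e_r$, $\beta=\sum_{r=0}^{7}\lambda_2^{r}e_r$ in $\mathbb{O}$. Then the ordinary and exponential generating functions of the $k$-Mersenne octonions are, as formal power series in $x$ with coefficients in $\mathbb{O}$: 1. $\displaystyle\sum_{n=0}^{\infty}M\mathbb{O}_{k,n}x^n=\frac{M\mathbb{O}_{k,0}+x\left(M\mathbb{O}_{k,1}-3kM\mathbb{O}_{k,0}\right)}{1-3kx+2x^2}$; 2. $\displaystyle\sum_{n=0}^{\infty}\frac{M\mathbb{O}_{k,n}x^n}{n!}=\frac{\alpha e^{\lambda_1x}-\beta e^{\lambda_2x}}{\sqrt{9k^2-8}}$.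
   Context: $\mathbb{O}$ denotes the octonions, the $8$-dimensional real algebra with basis $e_0=1,e_1,\dots,e_7$ (only its real vector space structure is needed here). Formal power series over $\mathbb{O}$ are multiplied by real formal power series coefficientwise in the usual way; $e^{\lambda x}=\sum_{n\ge0}\lambda^nx^n/n!$, and division by $1-3kx+2x^2$ means multiplication by its inverse in $\mathbb{R}[[x]]$. The $k$-Mersenne numbers are defined by $M_{k,0}=0$, $M_{k,1}=1$, $M_{k,n+1}=3kM_{k,n}-2M_{k,n-1}$ for $n\ge1$. The $n$-th $k$-Mersenne octonion is $M\mathbb{O}_{k,n}=\sum_{r=0}^{7}M_{k,n+r}e_r$ for $n\ge 0$. *)

theory Defs
  imports "HOL-Analysis.Finite_Cartesian_Product"
    "HOL-Library.Numeral_Type"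
    "HOL-Computational_Algebra.Formal_Power_Series"
begin

text \<open>
  Octonions with their real vector space structure only; the octonion product plays no role here.
  A separate type is used because \<^typ>\<open>real ^ 8\<close> already carries the componentwise product,
  which is not the octonion product.
\<close>

typedef octonion = "UNIV :: (real ^ 8) set"
  morphisms octonion_coords Octonion ..

setup_lifting type_definition_octonion

instantiation octonion :: real_vector
begin

lift_definition zero_octonion :: octonion is 0 .
lift_definition plus_octonion :: "octonion \<Rightarrow> octonion \<Rightarrow> octonion" is "(+)" .
lift_definition minus_octonion :: "octonion \<Rightarrow> octonion \<Rightarrow> octonion" is "(-)" .
lift_definition uminus_octonion :: "octonion \<Rightarrow> octonion" is uminus .
lift_definition scaleR_octonion :: "real \<Rightarrow> octonion \<Rightarrow> octonion" is scaleR .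

instance
  by standard (transfer; simp add: algebra_simps)+

end

text \<open>
  The basis vector \<open>e\<^sub>r\<close>, meant for \<open>r \<le> 7\<close>: the index type \<^typ>\<open>8\<close> consists of the
  residues modulo 8, so the index of a larger \<open>r\<close> would wrap around.
\<close>

lift_definition oct_basis :: "nat \<Rightarrow> octonion" is "\<lambda>r. axis (of_nat r) 1" .

fun mersenne :: "real \<Rightarrow> nat \<Rightarrow> real" where
  "mersenne k 0 = 0"
| "mersenne k (Suc 0) = 1"
| "mersenne k (Suc (Suc n)) = 3 * k * mersenne k (Suc n) - 2 * mersenne k n"

definition mersenne_oct :: "real \<Rightarrow> nat \<Rightarrow> octonion" where
  "mersenne_oct k n = (\<Sum>r=0..7. mersenne k (n + r) *\<^sub>R oct_basis r)"

text \<open>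
  Cauchy product of a real power series with a vector-valued one; the library product on
  \<^typ>\<open>'a fps\<close> needs both factors over the same ring.
\<close>

definition fps_scale :: "real fps \<Rightarrow> 'a::real_vector fps \<Rightarrow> 'a fps"  (infixr \<open>\<odot>\<close> 75) where
  "f \<odot> g = Abs_fps (\<lambda>n. \<Sum>i=0..n. fps_nth f i *\<^sub>R fps_nth g (n - i))"

end

theory Submission
  imports Defs
begin

text \<open>
  The vector-valued power series form a module over the ring of real power series, with
  scalar multiplication \<open>\<odot>\<close>. Both generating functions follow from this and from the three-term
  recurrence.

  For the ordinary one, let \<open>A\<close> be the series and \<open>D = 1 - 3 k x + 2 x\<^sup>2\<close>. The octonions
  \<open>MO\<^sub>k\<^sub>,\<^sub>n\<close> satisfy the same recurrence as the numbers, because their coordinates are shifts of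
  the number sequence and the recurrence is linear. Since \<open>D\<close> is its reciprocal characteristic
  polynomial, the coefficients of \<open>D \<odot> A\<close> vanish from degree two on, so that \<open>D \<odot> A\<close> is the
  linear numerator. As \<open>D\<close> has constant coefficient one, it is invertible, and associativity
  of the module action gives \<open>A = inverse D \<odot> (D \<odot> A)\<close>.

  For the exponential one, \<open>\<lambda>\<^sub>1\<close> and \<open>\<lambda>\<^sub>2\<close> are the characteristic roots and differ by
  \<open>sqrt (9 k\<^sup>2 - 8)\<close>, which is positive. The Binet formula for the numbers, applied in the
  coordinate \<open>e\<^sub>r\<close>, contributes the factors \<open>\<lambda>\<^sub>1\<^sup>r\<close> and \<open>\<lambda>\<^sub>2\<^sup>r\<close> that make up \<open>\<alpha>\<close> and \<open>\<beta>\<close>;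
  dividing by \<open>n!\<close> produces the coefficients of the exponentials.
\<close>

lemma fps_scale_nth:
  "fps_nth (f \<odot> g) n = (\<Sum>i=0..n. fps_nth f i *\<^sub>R fps_nth g (n - i))"
  by (simp add: fps_scale_def)

text \<open>Same regrouping of a sum over triples of indices with total \<open>n\<close> as for the ring product.\<close>

lemma fps_scale_assoc:
  "(f * g) \<odot> h = f \<odot> (g \<odot> h)"
proof (rule fps_ext)
  fix n
  have "fps_nth ((f * g) \<odot> h) n =
      (\<Sum>j=0..n. \<Sum>i=0..j. (fps_nth f i * fps_nth g (j - i)) *\<^sub>R fps_nth h (n - j))"
    by (simp add: fps_scale_nth fps_mult_nth scaleR_left.sum)
  also have "\<dots> = (\<Sum>j=0..n. \<Sum>i=0..n - j. (fps_nth f j * fps_nth g i) *\<^sub>R fps_nth h (n - j - i))"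
    by (rule fps_mult_assoc_lemma)
  also have "\<dots> = fps_nth (f \<odot> (g \<odot> h)) n"
    by (simp add: fps_scale_nth scaleR_sum_right)
  finally show "fps_nth ((f * g) \<odot> h) n = fps_nth (f \<odot> (g \<odot> h)) n" .
qed

lemma fps_scale_add_left: "(f + g) \<odot> h = f \<odot> h + g \<odot> h"
  by (rule fps_ext) (simp add: fps_scale_nth scaleR_add_left sum.distrib)

lemma fps_scale_diff_left: "(f - g) \<odot> h = f \<odot> h - g \<odot> h"
  by (rule fps_ext) (simp add: fps_scale_nth scaleR_diff_left sum_subtractf)

lemma fps_const_scale_nth: "fps_nth (fps_const c \<odot> h) n = c *\<^sub>R fps_nth h n"
proof -
  have "fps_nth (fps_const c \<odot> h) n = (\<Sum>i=0..n. if i = 0 then c *\<^sub>R fps_nth h n else 0)"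
    unfolding fps_scale_nth by (rule sum.cong) auto
  then show ?thesis by simp
qed

lemma fps_one_scale: "1 \<odot> h = h"
  by (rule fps_ext) (simp add: fps_const_scale_nth flip: fps_const_1_eq_1)

lemma fps_X_scale_nth: "fps_nth (fps_X \<odot> h) n = (if n = 0 then 0 else fps_nth h (n - 1))"
proof -
  have "fps_nth (fps_X \<odot> h) n = (\<Sum>i=0..n. if i = 1 then fps_nth h (n - 1) else 0)"
    unfolding fps_scale_nth by (rule sum.cong) auto
  then show ?thesis by simp
qed

lemma fps_scale_const_nth: "fps_nth (f \<odot> fps_const v) n = fps_nth f n *\<^sub>R v"
proof -
  have "fps_nth (f \<odot> fps_const v) n = (\<Sum>i=0..n. if i = n then fps_nth f n *\<^sub>R v else 0)"
    unfolding fps_scale_nth by (rule sum.cong) auto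
  then show ?thesis by simp
qed

lemma fps_eq_inverse_scale:
  assumes "fps_nth d 0 \<noteq> 0" and "d \<odot> a = p"
  shows "a = inverse d \<odot> p"
proof -
  have "inverse d \<odot> p = (inverse d * d) \<odot> a"
    using assms(2) by (simp add: fps_scale_assoc)
  also have "\<dots> = a"
    using assms(1) by (simp add: inverse_mult_eq_1 fps_one_scale)
  finally show ?thesis by simp
qed

text \<open>
  The denominator, acting on the series, annihilates every coefficient that the recurrence
  governs and leaves only the contribution of the two initial values.
\<close>

lemma fps_linear_recurrence_order_two:
  fixes u :: "nat \<Rightarrow> 'a::real_vector"
  assumes rec: "\<And>n. u (Suc (Suc n)) = p *\<^sub>R u (Suc n) - q *\<^sub>R u n"
  shows "Abs_fps u = inverse (1 - fps_const p * fps_X + fps_const q * fps_X\<^sup>2) \<odot>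
    (fps_const (u 0) + fps_X \<odot> fps_const (u 1 - p *\<^sub>R u 0))"
proof (rule fps_eq_inverse_scale)
  show "fps_nth (1 - fps_const p * fps_X + fps_const q * fps_X\<^sup>2) 0 \<noteq> 0"
    by simp
  show "(1 - fps_const p * fps_X + fps_const q * fps_X\<^sup>2) \<odot> Abs_fps u =
      fps_const (u 0) + fps_X \<odot> fps_const (u 1 - p *\<^sub>R u 0)" (is "?l = ?r")
  proof (rule fps_ext)
    fix n
    consider "n = 0" | "n = 1" | m where "n = Suc (Suc m)"
      by (metis One_nat_def not0_implies_Suc)
    then show "fps_nth ?l n = fps_nth ?r n"
      by cases (simp_all add: power2_eq_square fps_scale_add_left fps_scale_diff_left
          fps_scale_assoc fps_one_scale fps_const_scale_nth fps_X_scale_nth rec)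
  qed
qed

lemma mersenne_oct_recurrence:
  "mersenne_oct k (Suc (Suc n)) = (3 * k) *\<^sub>R mersenne_oct k (Suc n) - 2 *\<^sub>R mersenne_oct k n"
  by (simp add: mersenne_oct_def scaleR_sum_right scaleR_diff_left flip: sum_subtractf)

text \<open>
  Both \<open>a\<close> and \<open>b\<close> are roots of \<open>t\<^sup>2 - 3 k t + 2\<close>, so their powers solve the recurrence, and
  the difference \<open>a\<^sup>n - b\<^sup>n\<close> has the initial values \<open>0\<close> and \<open>a - b\<close>.
\<close>

lemma mersenne_binet:
  assumes "a + b = 3 * k" and "a * b = 2"
  shows "(a - b) * mersenne k n = a ^ n - b ^ n"
proof (induction n rule: induct_nat_012)
  case (ge2 n)
  have "(a - b) * mersenne k (Suc (Suc n)) =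
      (3 * k) * ((a - b) * mersenne k (Suc n)) - 2 * ((a - b) * mersenne k n)"
    by (simp add: algebra_simps)
  also have "\<dots> = (a + b) * (a ^ Suc n - b ^ Suc n) - (a * b) * (a ^ n - b ^ n)"
    by (simp only: ge2 assms)
  also have "\<dots> = a ^ Suc (Suc n) - b ^ Suc (Suc n)"
    by (simp add: algebra_simps)
  finally show ?case .
qed simp_all

lemma mersenne_oct_binet:
  assumes "a + b = 3 * k" and "a * b = 2"
  shows "(a - b) *\<^sub>R mersenne_oct k n =
    a ^ n *\<^sub>R (\<Sum>r=0..7. a ^ r *\<^sub>R oct_basis r) - b ^ n *\<^sub>R (\<Sum>r=0..7. b ^ r *\<^sub>R oct_basis r)"
  by (simp add: mersenne_oct_def scaleR_sum_right mersenne_binet[OF assms] power_add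
      scaleR_diff_left flip: sum_subtractf)

theorem theorem2p7:
  fixes k lambda1 lambda2 :: real and \<alpha> \<beta> :: octonion
  assumes "9 * k\<^sup>2 > 8"
    and "lambda1 = (3 * k + sqrt (9 * k\<^sup>2 - 8)) / 2"
    and "lambda2 = (3 * k - sqrt (9 * k\<^sup>2 - 8)) / 2"
    and "\<alpha> = (\<Sum>r=0..7. lambda1 ^ r *\<^sub>R oct_basis r)"
    and "\<beta> = (\<Sum>r=0..7. lambda2 ^ r *\<^sub>R oct_basis r)"
  shows "Abs_fps (\<lambda>n. mersenne_oct k n) =
           inverse (1 - fps_const (3 * k) * fps_X + fps_const 2 * fps_X\<^sup>2) \<odot>
             (fps_const (mersenne_oct k 0) +
              fps_X \<odot> fps_const (mersenne_oct k 1 - (3 * k) *\<^sub>R mersenne_oct k 0)) \<and>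
         Abs_fps (\<lambda>n. (1 / fact n) *\<^sub>R mersenne_oct k n) =
           fps_const (1 / sqrt (9 * k\<^sup>2 - 8)) \<odot>
             (fps_exp lambda1 \<odot> fps_const \<alpha> - fps_exp lambda2 \<odot> fps_const \<beta>)"
proof
  show "Abs_fps (\<lambda>n. mersenne_oct k n) =
      inverse (1 - fps_const (3 * k) * fps_X + fps_const 2 * fps_X\<^sup>2) \<odot>
        (fps_const (mersenne_oct k 0) +
         fps_X \<odot> fps_const (mersenne_oct k 1 - (3 * k) *\<^sub>R mersenne_oct k 0))"
    by (rule fps_linear_recurrence_order_two) (rule mersenne_oct_recurrence)
next
  define s where "s = sqrt (9 * k\<^sup>2 - 8)"
  have s_pos: "s > 0" and s_sq: "s * s = 9 * k\<^sup>2 - 8"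
    using assms(1) by (simp_all add: s_def)
  have roots: "lambda1 + lambda2 = 3 * k" "lambda1 * lambda2 = 2" "lambda1 - lambda2 = s"
    using s_sq unfolding assms(2,3) s_def[symmetric]
    by (simp_all add: field_simps power2_eq_square)
  have binet: "s *\<^sub>R mersenne_oct k n = lambda1 ^ n *\<^sub>R \<alpha> - lambda2 ^ n *\<^sub>R \<beta>" for n
    using mersenne_oct_binet[OF roots(1,2)] by (simp add: roots(3) assms(4,5))
  show "Abs_fps (\<lambda>n. (1 / fact n) *\<^sub>R mersenne_oct k n) =
      fps_const (1 / sqrt (9 * k\<^sup>2 - 8)) \<odot>
        (fps_exp lambda1 \<odot> fps_const \<alpha> - fps_exp lambda2 \<odot> fps_const \<beta>)"
  proof (rule fps_ext)
    fix n
    have "(1 / fact n) *\<^sub>R mersenne_oct k n =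
        (1 / s) *\<^sub>R (1 / fact n) *\<^sub>R (s *\<^sub>R mersenne_oct k n)"
      using s_pos by simp
    also have "\<dots> = (1 / s) *\<^sub>R ((lambda1 ^ n / fact n) *\<^sub>R \<alpha> - (lambda2 ^ n / fact n) *\<^sub>R \<beta>)"
      unfolding binet by (simp add: scaleR_diff_right)
    finally show "fps_nth (Abs_fps (\<lambda>n. (1 / fact n) *\<^sub>R mersenne_oct k n)) n =
        fps_nth (fps_const (1 / sqrt (9 * k\<^sup>2 - 8)) \<odot>
          (fps_exp lambda1 \<odot> fps_const \<alpha> - fps_exp lambda2 \<odot> fps_const \<beta>)) n"
      by (simp add: fps_const_scale_nth fps_scale_const_nth s_def)
  qed
qed

end
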